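(* Every deterministic online algorithm for problem SP has competitive ratio at least $3$.
   Context: Fix a horizon $T\in\mathbb{N}$, a constant cancellation fee $\beta>0$ and a constant $H$. At each time $t\in\{1,\dots,T\}$ an input $\sigma_t=(e_t,p^0_t,p^1_t,B_t)$ determines a cost function $g_t:\{0,1\}\to\mathbb{R}$ by $g_t(1)=e_t p^1_t$ and $g_t(0)=e_t p^0_t+(p^1_t-p^0_t)(e_t-1.1B_t)^+-H(0.9B_t-e_t)^+$, where $(x)^+=\max\{x,0\}$; these cost functions are taken to be nonnegative. Problem SP: given $\boldsymbol{\sigma}=(\sigma_1,\dots,\sigma_T)$, minimize $\mathrm{Cost}(\boldsymbol{s})=\sum_{t=1}^T\big(g_t(s_t)+\beta(s_t-s_{t-1})^+\big)$ over $(s_1,\dots,s_T)\in\{0,1\}^T$, with initial state $s_0=0$; $\mathrm{Opt}(s_0,\boldsymbol{\sigma})$ is the optimal value. A deterministic online algorithm $\mathcal{A}$ chooses each $s_t$ based only on $\sigma_1,\dots,\sigma_t$; it is $c$-competitive if there is a constant $\gamma(s_0)$ depending only on $s_0$ with $\mathrm{Cost}_{\mathcal{A}}(s_0,\boldsymbol{\sigma})\le c\cdot\mathrm{Opt}(s_0,\boldsymbol{\sigma})+\gamma(s_0)$ for all input sequences $\boldsymbol{\sigma}$; its competitive ratio is the smallest such $c$. *)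

theory Defs
  imports Complex_Main "HOL-Library.Extended_Real"
begin

abbreviation pos_part :: "real \<Rightarrow> real" where
  "pos_part x \<equiv> max x 0"

text \<open>States 0 and 1 are represented by \<^term>\<open>False\<close> and \<^term>\<open>True\<close>.
  An input is a tuple \<open>(e, p0, p1, B)\<close>.\<close>

type_synonym state = bool
type_synonym sp_input = "real \<times> real \<times> real \<times> real"

fun stage_cost :: "real \<Rightarrow> sp_input \<Rightarrow> state \<Rightarrow> real" where
  "stage_cost H (e, p0, p1, B) s =
     (if s then e * p1
      else e * p0 + (p1 - p0) * pos_part (e - 1.1 * B) - H * pos_part (0.9 * B - e))"

definition admissible :: "real \<Rightarrow> sp_input list \<Rightarrow> bool" where
  "admissible H \<sigma> \<longleftrightarrow> (\<forall>x \<in> set \<sigma>. \<forall>s. 0 \<le> stage_cost H x s)"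

text \<open>List positions start at 0, so \<open>\<sigma>\<^sub>t\<close> is \<open>\<sigma> ! (t - 1)\<close>, while \<open>(s0 # s) ! t\<close> is
  \<open>s\<^sub>t\<close> for every \<open>t\<close> from 0 to the horizon \<open>length \<sigma>\<close>.\<close>

definition Cost :: "real \<Rightarrow> real \<Rightarrow> state \<Rightarrow> sp_input list \<Rightarrow> state list \<Rightarrow> real" where
  "Cost \<beta> H s0 \<sigma> s =
     (\<Sum>t = 1..length \<sigma>. stage_cost H (\<sigma> ! (t - 1)) ((s0 # s) ! t)
        + \<beta> * pos_part (of_bool ((s0 # s) ! t) - of_bool ((s0 # s) ! (t - 1))))"

definition Opt :: "real \<Rightarrow> real \<Rightarrow> state \<Rightarrow> sp_input list \<Rightarrow> real" where
  "Opt \<beta> H s0 \<sigma> = Min (Cost \<beta> H s0 \<sigma> ` {s. length s = length \<sigma>})"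

text \<open>\<open>A T [\<sigma>\<^sub>1, \<dots>, \<sigma>\<^sub>t]\<close> is the state chosen at time \<open>t\<close>. The horizon \<open>T\<close> is fixed in
  advance in each instance, so the algorithm may depend on it.\<close>

type_synonym online_algorithm = "nat \<Rightarrow> sp_input list \<Rightarrow> state"

definition run :: "online_algorithm \<Rightarrow> sp_input list \<Rightarrow> state list" where
  "run A \<sigma> = map (\<lambda>t. A (length \<sigma>) (take t \<sigma>)) [1..<Suc (length \<sigma>)]"

text \<open>The constant \<open>\<gamma>\<close> may depend on the initial state only; in particular it is uniform
  in the horizon \<open>length \<sigma>\<close>. (For a single fixed horizon \<open>T\<close>, the choice \<open>\<gamma> = T * \<beta>\<close> would
  make the algorithm that minimises each stage cost 1-competitive.)\<close>

definition competitive ::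
  "real \<Rightarrow> real \<Rightarrow> state \<Rightarrow> online_algorithm \<Rightarrow> real \<Rightarrow> bool" where
  "competitive \<beta> H s0 A c \<longleftrightarrow>
     (\<exists>\<gamma>. \<forall>\<sigma>. admissible H \<sigma> \<longrightarrow> Cost \<beta> H s0 \<sigma> (run A \<sigma>) \<le> c * Opt \<beta> H s0 \<sigma> + \<gamma>)"

text \<open>Infimum in the extended reals: \<open>\<infinity>\<close> if the algorithm is not \<open>c\<close>-competitive for any \<open>c\<close>.\<close>

definition competitive_ratio :: "real \<Rightarrow> real \<Rightarrow> state \<Rightarrow> online_algorithm \<Rightarrow> ereal" where
  "competitive_ratio \<beta> H s0 A = Inf (ereal ` {c. competitive \<beta> H s0 A c})"

end

theory Submission
  imports Defs
begin

text \<open>A cruel adversary charges a small cost \<open>\<epsilon>\<close> to the state that the algorithm occupied last and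
  nothing to the other one. Three offline strategies compete: stay in 0, move to 1 and stay there,
  and always sit in the free state. The first two together pay \<open>\<epsilon>\<close> per step, and the third pays
  \<open>\<beta>\<close> once for each round trip of the algorithm. So the three together pay, up to a constant and a
  factor tending to 1 as \<open>\<epsilon>\<close> tends to 0, no more than the algorithm, and the best of them pays at
  most a third of that. The cost of the algorithm itself is unbounded in the horizon.\<close>

text \<open>With \<open>e = B = 1\<close> both positive parts in the stage cost vanish, which leaves \<open>p0\<close> and \<open>p1\<close>
  as the costs of the two states.\<close>

definition charge :: "real \<Rightarrow> state \<Rightarrow> sp_input" where
  "charge \<epsilon> b = (1, if b then 0 else \<epsilon>, if b then \<epsilon> else 0, 1)"

lemma stage_cost_charge: "stage_cost H (charge \<epsilon> b) s = (if s = b then \<epsilon> else 0)"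
  by (simp add: charge_def)

text \<open>\<open>run\<close> never queries \<open>A\<close> on the empty list, so the initial
  state 0 has to be put in there by hand.\<close>

definition last_state :: "online_algorithm \<Rightarrow> nat \<Rightarrow> sp_input list \<Rightarrow> state" where
  "last_state A T xs \<longleftrightarrow> xs \<noteq> [] \<and> A T xs"

text \<open>The announced horizon \<open>T\<close> is kept apart from the number of inputs issued so
  far, so that every prefix is again an \<open>adversary\<close> facing the same algorithm.\<close>

primrec adversary :: "online_algorithm \<Rightarrow> nat \<Rightarrow> real \<Rightarrow> nat \<Rightarrow> sp_input list" where
  "adversary A T \<epsilon> 0 = []"
| "adversary A T \<epsilon> (Suc n) =
     adversary A T \<epsilon> n @ [charge \<epsilon> (last_state A T (adversary A T \<epsilon> n))]"

lemma length_adversary [simp]: "length (adversary A T \<epsilon> n) = n"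
  by (induction n) auto

lemma take_adversary: "m \<le> n \<Longrightarrow> take m (adversary A T \<epsilon> n) = adversary A T \<epsilon> m"
  by (induction n) (auto simp: le_Suc_eq)

lemma nth_adversary:
  "m < n \<Longrightarrow> adversary A T \<epsilon> n ! m = charge \<epsilon> (last_state A T (adversary A T \<epsilon> m))"
  by (induction n) (auto simp: nth_append less_Suc_eq)

lemma admissible_adversary: "\<epsilon> \<ge> 0 \<Longrightarrow> admissible H (adversary A T \<epsilon> n)"
  by (induction n) (auto simp: admissible_def stage_cost_charge)

lemma run_adversary:
  "run A (adversary A T \<epsilon> T) = map (\<lambda>t. last_state A T (adversary A T \<epsilon> t)) [1..<Suc T]"
  by (auto simp: run_def take_adversary last_state_def simp flip: length_0_conv)

text \<open>The state charged at time \<open>Suc t\<close> is \<open>a t\<close>, the one the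
  algorithm held at time \<open>t\<close>. Taking \<open>f = a\<close> gives the cost of the
  algorithm itself, which pays \<epsilon> exactly when it stays put.\<close>

definition path_cost :: "real \<Rightarrow> real \<Rightarrow> (nat \<Rightarrow> state) \<Rightarrow> (nat \<Rightarrow> state) \<Rightarrow> nat \<Rightarrow> real" where
  "path_cost \<beta> \<epsilon> a f n = (\<Sum>t<n. (if f (Suc t) = a t then \<epsilon> else 0)
     + \<beta> * pos_part (of_bool (f (Suc t)) - of_bool (f t)))"

lemma path_cost_0: "path_cost \<beta> \<epsilon> a f 0 = 0"
  by (simp add: path_cost_def)

lemma path_cost_Suc:
  "path_cost \<beta> \<epsilon> a f (Suc n) = path_cost \<beta> \<epsilon> a f n + (if f (Suc n) = a n then \<epsilon> else 0)
     + \<beta> * pos_part (of_bool (f (Suc n)) - of_bool (f n))"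
  by (simp add: path_cost_def)

lemma Cost_adversary:
  assumes "f 0 = s0"
  shows "Cost \<beta> H s0 (adversary A T \<epsilon> T) (map f [1..<Suc T]) =
    path_cost \<beta> \<epsilon> (\<lambda>t. last_state A T (adversary A T \<epsilon> t)) f T"
proof -
  define l where "l = s0 # map f [1..<Suc T]"
  have nth: "l ! t = f t" if "t \<le> T" for t
    using that assms by (cases t) (auto simp: l_def simp del: upt_Suc)
  show ?thesis
    unfolding Cost_def path_cost_def length_adversary l_def[symmetric]
    by (rule sum.reindex_bij_witness[of _ Suc "\<lambda>t. t - 1"])
       (auto simp: nth nth_adversary stage_cost_charge)
qed

lemma finite_lists_of_length: "finite {s :: state list. length s = n}"
  using finite_lists_length_eq[of "UNIV :: state set" n] by simp

lemma Opt_le: "length s = length \<sigma> \<Longrightarrow> Opt \<beta> H s0 \<sigma> \<le> Cost \<beta> H s0 \<sigma> s"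
  unfolding Opt_def by (intro Min_le finite_imageI finite_lists_of_length) auto

lemma Opt_nonneg:
  assumes "\<beta> \<ge> 0" "admissible H \<sigma>"
  shows "Opt \<beta> H s0 \<sigma> \<ge> 0"
proof -
  have "Cost \<beta> H s0 \<sigma> s \<ge> 0" for s
    unfolding Cost_def using assms
    by (intro sum_nonneg add_nonneg_nonneg mult_nonneg_nonneg) (auto simp: admissible_def)
  moreover have "{s :: state list. length s = length \<sigma>} \<noteq> {}"
    using Ex_list_of_length[of "length \<sigma>"] by auto
  ultimately show ?thesis
    unfolding Opt_def by (subst Min_ge_iff) (auto intro: finite_lists_of_length)
qed

text \<open>Staying costs \<epsilon>, and a move up costs \<beta>, enough for two steps at
  \<epsilon> each. The surplus is stored while in state 1 and pays for the free move down.\<close>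

lemma path_cost_self_ge:
  assumes "\<not> a 0" "\<epsilon> \<ge> 0" "2 * \<epsilon> \<le> \<beta>"
  shows "path_cost \<beta> \<epsilon> a a n \<ge> \<epsilon> * n + (if a n then \<epsilon> else 0)"
proof (induction n)
  case 0
  then show ?case using assms by (simp add: path_cost_def)
next
  case (Suc n)
  then show ?case using assms
    by (cases "a n"; cases "a (Suc n)") (auto simp: path_cost_def algebra_simps)
qed

text \<open>The last summand on the left anticipates the next move of the third strategy, and the
  subtracted term on the right is the potential that pays for it.\<close>

lemma three_strategies_le:
  assumes "\<not> a 0" "\<epsilon> \<ge> 0" "\<beta> > 0"
  shows "path_cost \<beta> \<epsilon> a (\<lambda>t. False) n + path_cost \<beta> \<epsilon> a (\<lambda>t. t > 0) n
      + path_cost \<beta> \<epsilon> a (\<lambda>t. t > 0 \<and> \<not> a (t - 1)) n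
      + (if n > 0 \<and> \<not> a n \<and> a (n - 1) then \<beta> else 0)
    \<le> (1 + 2 * \<epsilon> / \<beta>) * path_cost \<beta> \<epsilon> a a n + (if n > 0 then 2 * \<beta> else 0)
      - (if a n then \<beta> + \<epsilon> else 0)"
proof (induction n)
  case 0
  then show ?case using assms by (simp add: path_cost_def)
next
  case (Suc n)
  define k where "k = 2 * \<epsilon> / \<beta>"
  \<comment> \<open>The first two strategies pay \<epsilon> even when the algorithm moves and is not
    charged. The extra \<open>k * \<beta>\<close> on each move up covers this for that move and for
    the next move down.\<close>
  have k: "k * \<beta> = 2 * \<epsilon>" "k * \<epsilon> \<ge> 0" using assms by (simp_all add: k_def)
  have "n > 0" if "a n" using that assms by (cases n) auto
  then show ?case using assms(2,3) Suc[folded k_def] k unfolding k_def[symmetric]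
    \<comment> \<open>The case \<open>n = 0\<close> is separate because the second and third
      strategies then both move to 1, which is the source of \<open>2 * \<beta>\<close>.\<close>
    by (cases "n = 0"; cases "a n"; cases "a (Suc n)"; cases "a (n - 1)")
       (simp_all add: path_cost_Suc path_cost_0 distrib_left distrib_right)
qed

lemma three_Opt_adversary_le:
  fixes A T \<epsilon>
  defines "\<sigma> \<equiv> adversary A T \<epsilon> T"
  assumes "\<epsilon> \<ge> 0" "\<beta> > 0"
  shows "3 * Opt \<beta> H False \<sigma> \<le> (1 + 2 * \<epsilon> / \<beta>) * Cost \<beta> H False \<sigma> (run A \<sigma>) + 2 * \<beta>"
proof -
  define a where "a = (\<lambda>t. last_state A T (adversary A T \<epsilon> t))"
  have a0: "\<not> a 0" by (simp add: a_def last_state_def)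
  have Opt: "Opt \<beta> H False \<sigma> \<le> path_cost \<beta> \<epsilon> a f T" if "\<not> f 0" for f
  proof -
    have "Opt \<beta> H False \<sigma> \<le> Cost \<beta> H False \<sigma> (map f [1..<Suc T])"
      by (rule Opt_le) (simp add: \<sigma>_def)
    also have "\<dots> = path_cost \<beta> \<epsilon> a f T"
      unfolding \<sigma>_def a_def by (rule Cost_adversary) (use that in simp)
    finally show ?thesis .
  qed
  have alg: "Cost \<beta> H False \<sigma> (run A \<sigma>) = path_cost \<beta> \<epsilon> a a T"
    using a0 unfolding \<sigma>_def run_adversary a_def by (intro Cost_adversary) simp
  show ?thesis
    using Opt[of "\<lambda>t. False"] Opt[of "\<lambda>t. t > 0"] Opt[of "\<lambda>t. t > 0 \<and> \<not> a (t - 1)"]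
      three_strategies_le[where a = a and n = T, OF a0 assms(2,3)] assms(2,3) alg
    by (auto split: if_splits)
qed

lemma Cost_run_adversary_ge:
  assumes "\<epsilon> \<ge> 0" "2 * \<epsilon> \<le> \<beta>"
  shows "Cost \<beta> H False (adversary A T \<epsilon> T) (run A (adversary A T \<epsilon> T)) \<ge> \<epsilon> * T"
proof -
  define a where "a = (\<lambda>t. last_state A T (adversary A T \<epsilon> t))"
  have a0: "\<not> a 0" by (simp add: a_def last_state_def)
  have "Cost \<beta> H False (adversary A T \<epsilon> T) (run A (adversary A T \<epsilon> T)) =
      path_cost \<beta> \<epsilon> a a T"
    using a0 unfolding run_adversary a_def by (intro Cost_adversary) simp
  then show ?thesis
    using path_cost_self_ge[where a = a and n = T, OF a0 assms] assms by (auto split: if_splits)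
qed

lemma competitive_ge_3:
  assumes "\<beta> > 0" "competitive \<beta> H False A c"
  shows "c \<ge> 3"
proof (rule ccontr)
  assume "\<not> c \<ge> 3"
  \<comment> \<open>A negative \<open>c\<close> is raised to 0, which is harmless since the optimum
    is nonnegative, so that inequalities may be multiplied by \<open>d\<close>.\<close>
  define d where "d = max c 0"
  have d: "0 \<le> d" "d < 3" "c \<le> d" using \<open>\<not> c \<ge> 3\<close> by (auto simp: d_def)
  obtain \<gamma> where \<gamma>:
    "\<And>\<sigma>. admissible H \<sigma> \<Longrightarrow> Cost \<beta> H False \<sigma> (run A \<sigma>) \<le> c * Opt \<beta> H False \<sigma> + \<gamma>"
    using assms(2) by (auto simp: competitive_def)
  \<comment> \<open>Small enough that \<open>3 - d * (1 + 2 * \<delta>)\<close> keeps at least half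
    of the gap \<open>3 - d\<close>, and at most \<open>1 / 4\<close>, which yields
    \<open>2 * \<epsilon> \<le> \<beta>\<close>.\<close>
  define \<delta> where "\<delta> = (3 - d) / 12"
  define \<epsilon> where "\<epsilon> = \<delta> * \<beta>"
  have \<delta>: "\<delta> > 0" "\<delta> \<le> 1 / 4" using d by (auto simp: \<delta>_def)
  have \<epsilon>: "\<epsilon> > 0" "2 * \<epsilon> \<le> \<beta>" "\<epsilon> / \<beta> = \<delta>" using assms(1) \<delta> by (auto simp: \<epsilon>_def)
  \<comment> \<open>The horizon may be chosen after \<gamma>, as \<gamma> is uniform in it. The
    algorithm pays at least \<open>\<epsilon> * T\<close>, which will exceed what competitiveness
    allows.\<close>
  obtain T :: nat where T: "2 * d * \<beta> + 3 * \<gamma> < real T * ((3 - d) / 2 * \<epsilon>)"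
    using reals_Archimedean3[of "(3 - d) / 2 * \<epsilon>"] d \<epsilon>
    by (meson diff_gt_0_iff_gt half_gt_zero mult_pos_pos)
  define \<sigma> where "\<sigma> = adversary A T \<epsilon> T"
  define alg where "alg = Cost \<beta> H False \<sigma> (run A \<sigma>)"
  define opt where "opt = Opt \<beta> H False \<sigma>"
  have adm: "admissible H \<sigma>" using \<epsilon> by (simp add: \<sigma>_def admissible_adversary)
  have opt0: "opt \<ge> 0" using Opt_nonneg[OF _ adm] assms(1) by (simp add: opt_def)
  have opt3: "3 * opt \<le> (1 + 2 * \<delta>) * alg + 2 * \<beta>"
    using three_Opt_adversary_le[of \<epsilon> \<beta> H A T] \<epsilon> assms(1)
    by (simp add: opt_def alg_def \<sigma>_def flip: \<epsilon>(3))
  have alg_ge: "alg \<ge> \<epsilon> * T"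
    using Cost_run_adversary_ge[of \<epsilon> \<beta> T H A] \<epsilon> by (simp add: alg_def \<sigma>_def)
  then have "alg \<ge> 0" using \<epsilon> by (smt (verit) mult_nonneg_nonneg of_nat_0_le_iff)
  have "alg \<le> c * opt + \<gamma>" using \<gamma>[OF adm] by (simp add: alg_def opt_def)
  also have "c * opt \<le> d * opt" using d opt0 by (intro mult_right_mono)
  finally have "3 * alg \<le> d * (3 * opt) + 3 * \<gamma>" by simp
  also have "d * (3 * opt) \<le> d * ((1 + 2 * \<delta>) * alg + 2 * \<beta>)"
    using opt3 d by (intro mult_left_mono)
  finally have alg_le: "(3 - d * (1 + 2 * \<delta>)) * alg \<le> 2 * d * \<beta> + 3 * \<gamma>"
    by (simp add: algebra_simps)
  have "3 - d * (1 + 2 * \<delta>) - (3 - d) / 2 = (3 - d) * (3 - d) / 6"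
    by (simp add: \<delta>_def field_simps)
  then have factor: "(3 - d) / 2 \<le> 3 - d * (1 + 2 * \<delta>)"
    using d by (smt (verit) divide_nonneg_pos mult_nonneg_nonneg)
  have "real T * ((3 - d) / 2 * \<epsilon>) = (3 - d) / 2 * (\<epsilon> * T)" by simp
  also have "\<dots> \<le> (3 - d) / 2 * alg"
    using alg_ge d by (intro mult_left_mono) auto
  also have "\<dots> \<le> (3 - d * (1 + 2 * \<delta>)) * alg"
    using factor \<open>alg \<ge> 0\<close> by (rule mult_right_mono)
  also note alg_le
  finally show False using T by (meson leD)
qed

theorem theorem4:
  fixes \<beta> H :: real and A :: online_algorithm
  assumes "\<beta> > 0"
  shows "competitive_ratio \<beta> H False A \<ge> 3"
  unfolding competitive_ratio_def
  using competitive_ge_3[OF assms] by (auto intro!: Inf_greatest)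

end
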